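(* Let $n\in\mathbb N$ and $i\in\{1,2\}$. Then $r(P_n,T_n^i)=2n-7$ for $n\ge 17$; $r(P_{n-1},T_n^i)=2n-7$ for $n\ge 13$; $r(P_{n-2},T_n^i)=2n-7$ for $n\ge 11$; and $r(P_{n-3},T_n^i)=2n-7$ for $n\ge 8$.
   Context: All graphs are finite and simple; a graph "contains" $H$ if it has a subgraph isomorphic to $H$. $P_m$ denotes the path on $m$ vertices. For graphs $G_1,G_2$, the Ramsey number $r(G_1,G_2)$ is the smallest positive integer $N$ such that for every graph $G$ on $N$ vertices, either $G$ contains a copy of $G_1$ or the complement $\overline G$ contains a copy of $G_2$. For $n\ge 5$, $T_n^1$ is the tree with vertex set $\{v_0,\ldots,v_{n-1}\}$ and edges $v_0v_1,\ldots,v_0v_{n-3},v_{n-4}v_{n-2},v_{n-3}v_{n-1}$, and $T_n^2$ is the tree on the same vertex set with edges $v_0v_1,\ldots,v_0v_{n-3},v_{n-3}v_{n-2},v_{n-3}v_{n-1}$. *)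

theory Defs
  imports Main
begin

text \<open>A graph is given by a vertex set and an adjacency predicate; only the
restriction of the predicate to the vertex set matters.\<close>

type_synonym 'a graph = "'a set \<times> ('a \<Rightarrow> 'a \<Rightarrow> bool)"

definition simple_graph :: "'a graph \<Rightarrow> bool" where
  "simple_graph G \<longleftrightarrow> finite (fst G) \<and>
     (\<forall>u\<in>fst G. \<forall>v\<in>fst G. snd G u v \<longleftrightarrow> snd G v u) \<and>
     (\<forall>u\<in>fst G. \<not> snd G u u)"

definition contains :: "'a graph \<Rightarrow> 'b graph \<Rightarrow> bool" where
  "contains G H \<longleftrightarrow> (\<exists>f. inj_on f (fst H) \<and> f ` fst H \<subseteq> fst G \<and>
     (\<forall>u\<in>fst H. \<forall>v\<in>fst H. snd H u v \<longrightarrow> snd G (f u) (f v)))"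

definition complement :: "'a graph \<Rightarrow> 'a graph" where
  "complement G = (fst G, \<lambda>u v. u \<noteq> v \<and> \<not> snd G u v)"

text \<open>Ramsey number: least positive N such that every simple graph on N
vertices (w.l.o.g. on the vertex set {0..<N}) contains G1 or its complement
contains G2.\<close>
definition ramsey :: "'a graph \<Rightarrow> 'b graph \<Rightarrow> nat" where
  "ramsey G1 G2 = (LEAST N. 0 < N \<and>
     (\<forall>E :: nat \<Rightarrow> nat \<Rightarrow> bool. simple_graph ({..<N}, E) \<longrightarrow>
        contains ({..<N}, E) G1 \<or> contains (complement ({..<N}, E)) G2))"

definition path_graph :: "nat \<Rightarrow> nat graph" where
  "path_graph m = ({..<m}, \<lambda>u v. u + 1 = v \<or> v + 1 = u)"

definition T1_rel :: "nat \<Rightarrow> nat \<Rightarrow> nat \<Rightarrow> bool" where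
  "T1_rel n u v \<longleftrightarrow> (u = 0 \<and> 1 \<le> v \<and> v \<le> n - 3) \<or>
     (u = n - 4 \<and> v = n - 2) \<or> (u = n - 3 \<and> v = n - 1)"

definition T2_rel :: "nat \<Rightarrow> nat \<Rightarrow> nat \<Rightarrow> bool" where
  "T2_rel n u v \<longleftrightarrow> (u = 0 \<and> 1 \<le> v \<and> v \<le> n - 3) \<or>
     (u = n - 3 \<and> v = n - 2) \<or> (u = n - 3 \<and> v = n - 1)"

definition tree_T :: "nat \<Rightarrow> nat \<Rightarrow> nat graph" where
  "tree_T i n = ({..<n}, \<lambda>u v. if i = 1 then T1_rel n u v \<or> T1_rel n v u
                                 else T2_rel n u v \<or> T2_rel n v u)"

end

theory Submission
  imports Defs
begin

text \<open>For the upper bound let \<open>G\<close> have \<open>2n - 7\<close> vertices. If every vertex has at most \<open>n - 4\<close>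
non-neighbours, then \<open>G\<close> has minimum degree at least \<open>n - 4\<close>, hence a Hamiltonian path by the
rotation argument of Dirac. Otherwise some \<open>v\<close> has a set \<open>A\<close> of at least \<open>n - 3\<close> non-neighbours;
let \<open>B\<close> be the set of its neighbours. If the complement contains no \<open>T\<^sub>n\<^sup>i\<close>, then, after deletion
of one vertex of \<open>A\<close>, every vertex of \<open>A\<close> misses at most one vertex of \<open>B\<close>, so a path zigzags
between \<open>A\<close> and \<open>B\<close> and covers \<open>B\<close>, the final gap being bridged by \<open>v\<close>. If \<open>A\<close> is so large
that this path is too short, then \<open>A\<close> itself is almost complete in \<open>G\<close>. For the lower bound take
two disjoint copies of \<open>K\<^bsub>n-4\<^esub>\<close>.\<close>

section \<open>Paths as vertex lists, and Hamiltonian paths from a minimum degree\<close>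

lemma contains_path_graphI:
  assumes "distinct ps" "set ps \<subseteq> V" "successively E ps" "m \<le> length ps"
    and sym: "\<And>u w. u \<in> V \<Longrightarrow> w \<in> V \<Longrightarrow> E u w \<Longrightarrow> E w u"
  shows "contains (V, E) (path_graph m)"
proof -
  have *: "E (ps ! k) (ps ! Suc k)" "E (ps ! Suc k) (ps ! k)" if "Suc k < m" for k
  proof -
    show "E (ps ! k) (ps ! Suc k)"
      using assms(3,4) that by (simp add: successively_conv_nth)
    then show "E (ps ! Suc k) (ps ! k)"
      using sym assms(2,4) that by (meson Suc_lessD nth_mem order_less_le_trans subsetD)
  qed
  have "inj_on ((!) ps) {..<m}"
    using assms(1,4) by (auto simp: inj_on_def nth_eq_iff_index_eq)
  moreover have "(!) ps ` {..<m} \<subseteq> V"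
    using assms(2,4) by (auto simp: subset_iff)
  ultimately show ?thesis
    unfolding contains_def path_graph_def using * by (auto intro!: exI[of _ "(!) ps"])
qed

text \<open>Take a longest path and a vertex \<open>w\<close> off it. All neighbours of both ends
  lie on the path, so a rotation turns it into a cycle on the same vertices. The first vertex and
  \<open>w\<close> are non-adjacent of degree at least \<open>k\<close>, so they share a neighbour
  \<open>z\<close>; opening the cycle at \<open>z\<close> and appending \<open>w\<close> gives a
  longer path.\<close>

lemma Hamiltonian_path_min_degree:
  fixes V :: "'a set"
  assumes "finite V"
    and sym: "\<And>u w. u \<in> V \<Longrightarrow> w \<in> V \<Longrightarrow> E u w \<Longrightarrow> E w u"
    and irr: "\<And>u. u \<in> V \<Longrightarrow> \<not> E u u"
    and deg: "\<And>u. u \<in> V \<Longrightarrow> k \<le> card {w \<in> V. E u w}"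
    and size: "card V \<le> 2 * k + 1"
  shows "\<exists>ps. distinct ps \<and> set ps = V \<and> successively E ps"
proof -
  define P where "P ps \<longleftrightarrow> distinct ps \<and> set ps \<subseteq> V \<and> successively E ps" for ps
  have "P []" by (simp add: P_def)
  moreover have bound: "length ps \<le> card V" if "P ps" for ps
    using that \<open>finite V\<close> by (metis P_def card_mono distinct_card)
  ultimately obtain ps where ps: "P ps" and longest: "\<And>qs. P qs \<Longrightarrow> length qs \<le> length ps"
    using ex_has_greatest_nat[of P "[]" length "Suc (card V)"] by (metis less_Suc_eq_le)
  show ?thesis
  proof (rule ccontr)
    assume neg: "\<not> ?thesis"
    define l where "l = length ps"
    from neg ps obtain w where w: "w \<in> V" "w \<notin> set ps" by (auto simp: P_def)
    have "P [w]" using w by (simp add: P_def)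
    then have "ps \<noteq> []" using longest by fastforce
    then have "0 < l" by (simp add: l_def)
    have l_less: "l < card V"
      using ps w \<open>finite V\<close> unfolding l_def P_def
      by (metis distinct_card psubsetI psubset_card_mono)
    have V: "ps ! j \<in> V" if "j < l" for j
      using ps that by (auto simp: P_def l_def)
    have hd: "u \<in> set ps" if "u \<in> V" "E (ps ! 0) u" for u
    proof (rule ccontr)
      assume "u \<notin> set ps"
      then have "P (u # ps)"
        using ps that sym[OF V] \<open>0 < l\<close> \<open>ps \<noteq> []\<close>
        by (auto simp: P_def successively_Cons hd_conv_nth)
      then show False using longest by fastforce
    qed
    \<comment> \<open>Stated for any ordering \<open>qs\<close> of the vertices of
      \<open>ps\<close>: it is applied to \<open>ps\<close> itself and, at the end, to the opened
      cycle.\<close>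
    have snoc: "False" if "P qs" "set qs = set ps" "qs \<noteq> []" "u \<in> V" "u \<notin> set ps" "E (last qs) u" for qs u
    proof -
      have "P (qs @ [u])" using that by (auto simp: P_def successively_append_iff)
      moreover have "length qs = length ps"
        using that ps by (metis P_def distinct_card)
      ultimately show False using longest by fastforce
    qed
    have last: "u \<in> set ps" if "u \<in> V" "E (ps ! (l - 1)) u" for u
      using snoc[OF ps refl \<open>ps \<noteq> []\<close> that(1)] that \<open>ps \<noteq> []\<close> by (auto simp: last_conv_nth l_def)
    \<comment> \<open>\<open>I\<close> holds the positions whose successor is a neighbour of the
      first vertex, \<open>J\<close> those that hold a neighbour of the last. Each has at least
      \<open>k\<close> elements among only \<open>l - 1 < 2 * k\<close> positions, so they
      meet.\<close>
    define I where "I = {j. j < l - 1 \<and> E (ps ! 0) (ps ! Suc j)}"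
    define J where "J = {j. j < l - 1 \<and> E (ps ! (l - 1)) (ps ! j)}"
    have fin: "finite I" "finite J" by (auto simp: I_def J_def)
    have "{u \<in> V. E (ps ! 0) u} \<subseteq> (\<lambda>j. ps ! Suc j) ` I"
    proof
      fix u assume "u \<in> {u \<in> V. E (ps ! 0) u}"
      then have u: "u \<in> V" "E (ps ! 0) u" by auto
      then obtain j where j: "j < l" "u = ps ! j"
        using hd by (metis in_set_conv_nth l_def)
      with u irr V obtain j' where "j = Suc j'" by (metis not0_implies_Suc)
      then show "u \<in> (\<lambda>j. ps ! Suc j) ` I" using j u by (auto simp: I_def)
    qed
    then have "k \<le> card I"
      using deg[OF V[OF \<open>0 < l\<close>]] fin by (meson le_trans surj_card_le)
    moreover have "{u \<in> V. E (ps ! (l - 1)) u} \<subseteq> (\<lambda>j. ps ! j) ` J"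
    proof
      fix u assume "u \<in> {u \<in> V. E (ps ! (l - 1)) u}"
      then have u: "u \<in> V" "E (ps ! (l - 1)) u" by auto
      then obtain j where j: "j < l" "u = ps ! j"
        using last by (metis in_set_conv_nth l_def)
      with u irr V have "j \<noteq> l - 1" by metis
      then show "u \<in> (\<lambda>j. ps ! j) ` J" using j u by (auto simp: J_def)
    qed
    then have "k \<le> card J"
      using deg[of "ps ! (l - 1)"] V \<open>0 < l\<close> fin
      by (metis (no_types, lifting) diff_less le_trans surj_card_le zero_less_one)
    moreover have "card (I \<union> J) \<le> l - 1"
      using card_mono[of "{..<l - 1}" "I \<union> J"] by (auto simp: I_def J_def)
    ultimately have "I \<inter> J \<noteq> {}"
      using card_Un_disjoint[OF fin] l_less size \<open>0 < l\<close> by linarith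
    then obtain j where j: "Suc j < l" "E (ps ! 0) (ps ! Suc j)" "E (ps ! (l - 1)) (ps ! j)"
      by (auto simp: I_def J_def less_diff_conv)
    \<comment> \<open>the cycle obtained by reversing the part of the path after position \<open>j\<close>\<close>
    define cs where "cs = take (Suc j) ps @ rev (drop (Suc j) ps)"
    have "ps = take (Suc j) ps @ drop (Suc j) ps" by simp
    then have succ: "successively E (take (Suc j) ps)" "successively E (drop (Suc j) ps)"
      using ps by (metis P_def successively_append_iff)+
    have "set (drop (Suc j) ps) \<subseteq> V"
      using ps by (meson P_def set_drop_subset subset_trans)
    then have "successively E (rev (drop (Suc j) ps))"
      unfolding successively_rev using sym by (intro successively_mono[OF succ(2)]) blast+
    moreover have "E (last (take (Suc j) ps)) (hd (rev (drop (Suc j) ps)))"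
    proof -
      have "last (take (Suc j) ps) = ps ! j"
        using j by (simp add: l_def take_Suc_conv_app_nth)
      moreover have "hd (rev (drop (Suc j) ps)) = ps ! (l - 1)"
        using j \<open>ps \<noteq> []\<close> by (simp only: hd_rev l_def last_drop last_conv_nth not_False_eq_True)
      ultimately show ?thesis using j(1,3) sym[OF V V] by simp
    qed
    ultimately have cs_succ: "successively E cs"
      using succ j by (auto simp: cs_def successively_append_iff)
    have cs_set: "set cs = set ps"
      unfolding cs_def by (metis append_take_drop_id set_append set_rev)
    have "length cs = length ps" by (simp add: cs_def)
    with cs_set ps have cs_dist: "distinct cs"
      by (metis P_def card_distinct distinct_card)
    have cs_close: "E (last cs) (hd cs)"
      using j sym V \<open>ps \<noteq> []\<close> unfolding cs_def l_def
      by (auto simp: last_rev hd_drop_conv_nth hd_append hd_conv_nth)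
    \<comment> \<open>Without a common neighbour the two neighbourhoods would be disjoint subsets of
      \<open>V - {w, ps ! 0}\<close>, which has at most \<open>2 * k - 1\<close> elements.\<close>
    have "\<not> E w (ps ! 0)" using hd[of w] w sym V \<open>0 < l\<close> by blast
    then have "\<exists>z\<in>V. E (ps ! 0) z \<and> E w z"
    proof (rule_tac ccontr)
      assume nz: "\<not> (\<exists>z\<in>V. E (ps ! 0) z \<and> E w z)"
      let ?M = "{z \<in> V. E (ps ! 0) z}" and ?N = "{z \<in> V. E w z}"
      have "card (?M \<union> ?N) = card ?M + card ?N"
        using nz \<open>finite V\<close> by (intro card_Un_disjoint) auto
      moreover have "?M \<union> ?N \<subseteq> V - {w, ps ! 0}"
        using irr w hd \<open>\<not> E w (ps ! 0)\<close> V[OF \<open>0 < l\<close>] by auto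
      then have "card (?M \<union> ?N) \<le> card (V - {w, ps ! 0})"
        using \<open>finite V\<close> by (simp add: card_mono)
      moreover have "w \<noteq> ps ! 0" using w \<open>ps \<noteq> []\<close> by (metis length_greater_0_conv nth_mem)
      then have "card (V - {w, ps ! 0}) = card V - 2"
        using w V[OF \<open>0 < l\<close>] \<open>finite V\<close> by (simp add: card_Diff_subset)
      ultimately show False
        using deg[OF w(1)] deg[OF V[OF \<open>0 < l\<close>]] size l_less \<open>0 < l\<close> by linarith
    qed
    then obtain z where z: "z \<in> V" "E (ps ! 0) z" "E w z" by blast
    then have "z \<in> set cs" using hd cs_set by auto
    then obtain us ws where split: "cs = us @ z # ws" by (meson split_list)
    \<comment> \<open>Walking around the cycle from just after \<open>z\<close> ends at
      \<open>z\<close>, a neighbour of \<open>w\<close>.\<close>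
    have "successively E (ws @ us @ [z])"
      using cs_succ cs_close unfolding split
      by (cases us; cases "ws = []") (auto simp: successively_append_iff successively_Cons hd_append)
    then have "P (ws @ us @ [z])"
      using cs_dist cs_set ps unfolding split by (auto simp: P_def)
    then show False
      using snoc[of "ws @ us @ [z]" w] cs_set w sym z unfolding split by auto
  qed
qed

section \<open>Zigzag paths between two vertex sets\<close>

text \<open>Two vertices of \<open>X\<close> together miss at most two vertices of \<open>Y\<close>,
  so while \<open>Y\<close> has three vertices they have a common neighbour there, through which the
  path steps from one to the other. Each step removes one vertex from either set, preserving
  \<open>card Y \<le> card X + 1\<close>. The start \<open>a\<close> is prescribed so that the
  recursive path can be prefixed.\<close>

lemma zigzag_path:
  assumes "finite X" "finite Y" "X \<inter> Y = {}" "v \<notin> X \<union> Y" "a \<in> X"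
    and "2 \<le> card Y" "card Y \<le> card X + 1"
    and "\<And>y. y \<in> Y \<Longrightarrow> E v y \<and> E y v"
    and "\<And>x y. x \<in> X \<Longrightarrow> y \<in> Y \<Longrightarrow> E x y \<Longrightarrow> E y x"
    and "\<And>x. x \<in> X \<Longrightarrow> card {y \<in> Y. \<not> E x y} \<le> 1"
  shows "\<exists>ps. distinct ps \<and> set ps \<subseteq> insert v (X \<union> Y) \<and> length ps = 2 * card Y \<and>
    successively E ps \<and> ps \<noteq> [] \<and> hd ps = a"
  using assms
proof (induction "card Y" arbitrary: X Y a)
  case 0
  then show ?case by simp
next
  case (Suc k)
  have missed: "card {y \<in> Y. \<not> E a y} \<le> 1" using Suc.prems by blast
  show ?case
  proof (cases "card Y = 2")
    case True
    have "\<exists>b\<in>Y. E a b"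
    proof (rule ccontr)
      assume "\<not> ?thesis"
      then have "{y \<in> Y. \<not> E a y} = Y" by auto
      with missed True show False by simp
    qed
    then obtain b where b: "b \<in> Y" "E a b" by blast
    then have "card (Y - {b}) = 1" using True Suc.prems by simp
    then obtain b' where "Y - {b} = {b'}" by (meson card_1_singletonE)
    then have b': "b' \<in> Y" "b' \<noteq> b" by auto
    show ?thesis
      \<comment> \<open>\<open>X\<close> may be down to \<open>a\<close> alone, so \<open>v\<close>,
        adjacent to all of \<open>Y\<close>, links the last two vertices of
        \<open>Y\<close>.\<close>
      using b b' True Suc.prems by (intro exI[of _ "[a, b, v, b']"]) auto
  next
    case False
    then have "3 \<le> card Y" using Suc.prems by linarith
    then have "2 \<le> card X" using Suc.prems by linarith
    then have "card (X - {a}) \<noteq> 0" using Suc.prems by simp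
    then have "X - {a} \<noteq> {}" by (metis card.empty)
    then obtain a' where a': "a' \<in> X" "a' \<noteq> a" by blast
    have "\<exists>b\<in>Y. E a b \<and> E a' b"
    proof (rule ccontr)
      assume "\<not> ?thesis"
      then have "Y = {y \<in> Y. \<not> E a y} \<union> {y \<in> Y. \<not> E a' y}" by auto
      then have "card Y \<le> card {y \<in> Y. \<not> E a y} + card {y \<in> Y. \<not> E a' y}"
        by (metis card_Un_le)
      with missed Suc.prems(10)[OF a'(1)] \<open>3 \<le> card Y\<close> show False by linarith
    qed
    then obtain b where b: "b \<in> Y" "E a b" "E a' b" by blast
    have "card {y \<in> Y - {b}. \<not> E x y} \<le> 1" if "x \<in> X - {a}" for x
      using Suc.prems(10)[of x] card_mono[of "{y \<in> Y. \<not> E x y}" "{y \<in> Y - {b}. \<not> E x y}"]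
        \<open>finite Y\<close> that by fastforce
    then have "\<exists>ps. distinct ps \<and> set ps \<subseteq> insert v ((X - {a}) \<union> (Y - {b})) \<and>
        length ps = 2 * card (Y - {b}) \<and> successively E ps \<and> ps \<noteq> [] \<and> hd ps = a'"
      using Suc.prems Suc.hyps(2) a' b \<open>3 \<le> card Y\<close> by (intro Suc.hyps(1)) auto
    then obtain ps where "distinct ps" "set ps \<subseteq> insert v ((X - {a}) \<union> (Y - {b}))"
      "length ps = 2 * card (Y - {b})" "successively E ps" "ps \<noteq> []" "hd ps = a'" by blast
    moreover have "Suc (card (Y - {b})) = card Y"
      using b Suc.prems by (simp add: card_Suc_Diff1)
    moreover have "E b a'" using b a' Suc.prems by blast
    ultimately show ?thesis
      using b Suc.prems(3,4,5) by (intro exI[of _ "a # b # ps"]) (auto simp: successively_Cons)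
  qed
qed

section \<open>Embedding the trees, and relations without matchings\<close>

text \<open>\<open>v\<close> becomes the centre, \<open>p\<close> and \<open>q\<close> the tree
  vertices \<open>n - 4\<close> and \<open>n - 3\<close>, and \<open>x\<close> and \<open>y\<close>
  the two outer leaves. As \<open>x\<close> and \<open>y\<close> may lie in \<open>A\<close>, the
  bound is on \<open>A - {x, y}\<close>: it must supply \<open>p\<close>, \<open>q\<close> and the
  other \<open>n - 5\<close> neighbours of \<open>v\<close>.\<close>

lemma contains_tree_TI:
  assumes "finite V" "A \<subseteq> V" "v \<in> V" "v \<notin> A" "5 \<le> n"
    and sym: "\<And>u w. u \<in> V \<Longrightarrow> w \<in> V \<Longrightarrow> F u w \<Longrightarrow> F w u"
    and star: "\<And>u. u \<in> A \<Longrightarrow> F v u"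
    and "p \<in> A" "q \<in> A" "p \<noteq> q" "x \<in> V" "y \<in> V" "x \<noteq> y" "x \<notin> {v, p, q}" "y \<notin> {v, p, q}"
    and card: "n - 3 \<le> card (A - {x, y})"
    and px: "F (if i = 1 then p else q) x" and qy: "F q y"
  shows "contains (V, F) (tree_T i n)"
proof -
  obtain k where n: "n = k + 5" using \<open>5 \<le> n\<close> by (metis add.commute le_iff_add)
  have "card (A - {x, y} - {p, q}) = card (A - {x, y}) - 2"
    using assms by (subst card_Diff_subset) auto
  then have "k \<le> card (A - {x, y} - {p, q})" using card n by simp
  then obtain R where R: "R \<subseteq> A - {x, y} - {p, q}" "card R = k" "finite R"
    by (metis obtain_subset_with_card_n)
  then obtain rs where rs: "set rs = R" "distinct rs" "length rs = k"
    by (metis distinct_card finite_distinct_list)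
  \<comment> \<open>The position in \<open>xs\<close> is the number of the tree vertex; with
    \<open>n = k + 5\<close> the last four are \<open>n - 4\<close> to \<open>n - 1\<close>.\<close>
  define xs where "xs = v # rs @ [p, q, x, y]"
  have len: "length xs = n" by (simp add: xs_def rs n)
  have dist: "distinct xs" using assms R rs by (auto simp: xs_def)
  have sub: "set xs \<subseteq> V" using assms R rs by (auto simp: xs_def)
  have nth: "xs ! 0 = v" "xs ! (k + 1) = p" "xs ! (k + 2) = q" "xs ! (k + 3) = x" "xs ! (k + 4) = y"
    by (auto simp: xs_def nth_append rs(3))
  have leaf: "F (xs ! 0) (xs ! j)" if j: "1 \<le> j" "j \<le> k + 2" for j
  proof -
    have "xs ! j = (rs @ [p, q]) ! (j - 1)"
      using j by (auto simp: xs_def nth_append rs(3) nth_Cons')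
    also have "\<dots> \<in> set (rs @ [p, q])" using j rs(3) by (intro nth_mem) simp
    also have "\<dots> \<subseteq> A" using assms R rs by auto
    finally show ?thesis using star nth(1) by simp
  qed
  define D where "D = (if i = 1 then T1_rel n else T2_rel n)"
  have edge: "F (xs ! u) (xs ! w)" if "D u w" for u w
    using that leaf px qy nth
    by (auto simp: D_def T1_rel_def T2_rel_def n eval_nat_numeral split: if_splits)
  have "inj_on ((!) xs) {..<n}"
    using dist len by (auto simp: inj_on_def nth_eq_iff_index_eq)
  moreover have "(!) xs ` {..<n} \<subseteq> V" using sub len by (auto simp: subset_iff)
  moreover have "F (xs ! u) (xs ! w)" if "u < n" "w < n" "D u w \<or> D w u" for u w
    using that edge sym sub len by (meson nth_mem subsetD)
  ultimately show ?thesis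
    unfolding contains_def tree_T_def
    by (intro exI[of _ "(!) xs"]) (auto simp: D_def split: if_splits)
qed

text \<open>\<open>R\<close> will be non-adjacency. If \<open>c\<close> is related to two vertices
  of \<open>B\<close>, any pair \<open>R z w\<close> with \<open>z \<noteq> c\<close> is disjoint
  from one of the two pairs at \<open>c\<close>; so deleting \<open>c\<close> leaves no pair at
  all.\<close>

lemma no_matching_star:
  assumes "A \<noteq> {}" "finite B"
    and no_matching: "\<And>p q x y. \<lbrakk>p \<in> A; q \<in> A; p \<noteq> q; x \<in> B; y \<in> B; x \<noteq> y; R p x; R q y\<rbrakk> \<Longrightarrow> False"
  shows "\<exists>c\<in>A. \<forall>z\<in>A - {c}. card {y \<in> B. R z y} \<le> 1"
proof (cases "\<forall>z\<in>A. card {y \<in> B. R z y} \<le> 1")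
  case True
  then show ?thesis using assms(1) by blast
next
  case False
  then obtain c x y where c: "c \<in> A" "x \<in> B" "y \<in> B" "x \<noteq> y" "R c x" "R c y"
    using \<open>finite B\<close> by (auto simp: card_le_Suc0_iff_eq)
  have "{y \<in> B. R z y} = {}" if "z \<in> A - {c}" for z
    using that c no_matching[of c z] by blast
  then show ?thesis using c(1) by (metis card.empty zero_le_one)
qed

text \<open>A graph without two disjoint edges is a star or a triangle.\<close>

lemma no_two_disjoint_edges:
  assumes "A \<noteq> {}" "finite A"
    and sym: "\<And>u w. u \<in> A \<Longrightarrow> w \<in> A \<Longrightarrow> R u w \<Longrightarrow> R w u"
    and irr: "\<And>u. \<not> R u u"
    and disj: "\<And>p q x y. \<lbrakk>p \<in> A; q \<in> A; x \<in> A; y \<in> A; p \<noteq> q; x \<noteq> y; x \<notin> {p, q}; y \<notin> {p, q}; R p x; R q y\<rbrakk>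
      \<Longrightarrow> False"
  shows "\<exists>c\<in>A. \<forall>z\<in>A - {c}. card {y \<in> A - {c}. R z y} \<le> 1"
proof (rule ccontr)
  assume "\<not> ?thesis"
  \<comment> \<open>If the claim fails, every deletion leaves a vertex with two neighbours. The
    first such cherry is centred at \<open>z\<close>; the second is taken after deleting
    \<open>z\<close>.\<close>
  then have cherry: "\<exists>z x y. z \<in> A - {c} \<and> x \<in> A - {c} \<and> y \<in> A - {c} \<and> x \<noteq> y \<and> R z x \<and> R z y"
    if "c \<in> A" for c
    using that \<open>finite A\<close> by (fastforce simp: card_le_Suc0_iff_eq)
  from \<open>A \<noteq> {}\<close> cherry obtain z x y
    where z: "z \<in> A" "x \<in> A" "y \<in> A" "x \<noteq> y" "R z x" "R z y" by blast
  from cherry[OF z(1)] obtain z' x' y' where z': "z' \<in> A" "x' \<in> A" "y' \<in> A"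
    "z' \<noteq> z" "x' \<noteq> z" "y' \<noteq> z" "x' \<noteq> y'" "R z' x'" "R z' y'" by blast
  \<comment> \<open>The pairs \<open>z s\<close> and \<open>z' s'\<close> must share a vertex, and
    the second avoids \<open>z\<close>, so only \<open>s' = s\<close> or \<open>z' = s\<close>
    remains. Varying \<open>s'\<close> forces \<open>z' = s\<close>, and this for both
    \<open>x\<close> and \<open>y\<close>.\<close>
  have meet: "s' = s \<or> z' = s" if "s \<in> {x, y}" "s' \<in> {x', y'}" for s s'
    using that z z' irr disj[of z z' s s'] by blast
  show False
    using meet[of x x'] meet[of x y'] meet[of y x'] meet[of y y'] z z' by blast
qed

lemma successively_clique:
  assumes "distinct ps" "\<And>u w. u \<in> set ps \<Longrightarrow> w \<in> set ps \<Longrightarrow> u \<noteq> w \<Longrightarrow> E u w"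
  shows "successively E ps"
  using assms by (induction ps rule: induct_list012) auto

section \<open>The upper bound\<close>

text \<open>The bounds on \<open>n\<close> ensure that a zigzag on \<open>2 * card B\<close>
  vertices is too short only if \<open>card A\<close> is at least both \<open>n - 1\<close> and
  \<open>m + 1\<close>, or if \<open>n = 8\<close>, \<open>m = 5\<close> and
  \<open>card A = 6\<close>.\<close>

lemma path_or_tree_in_complement:
  fixes V :: "'a set"
  assumes "finite V" and card_V: "card V = 2 * n - 7" and "8 \<le> n"
    and m: "m + 3 = n \<or> m + 2 = n \<and> 11 \<le> n \<or> m + 1 = n \<and> 13 \<le> n \<or> m = n \<and> 17 \<le> n"
    and sym: "\<And>u w. u \<in> V \<Longrightarrow> w \<in> V \<Longrightarrow> E u w \<Longrightarrow> E w u"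
    and irr: "\<And>u. u \<in> V \<Longrightarrow> \<not> E u u"
    and no_tree: "\<not> contains (complement (V, E)) (tree_T i n)"
  shows "\<exists>ps. distinct ps \<and> set ps \<subseteq> V \<and> successively E ps \<and> m \<le> length ps"
proof (cases "\<forall>v\<in>V. card {w \<in> V. w \<noteq> v \<and> \<not> E v w} \<le> n - 4")
  case True
  \<comment> \<open>Of the \<open>2 * n - 8\<close> other vertices at most \<open>n - 4\<close> are
    missed, and \<open>2 * n - 7 = 2 * (n - 4) + 1\<close> meets the size bound for a Hamiltonian
    path exactly.\<close>
  have "n - 4 \<le> card {w \<in> V. E v w}" if "v \<in> V" for v
  proof -
    have "V = insert v ({w \<in> V. w \<noteq> v \<and> \<not> E v w} \<union> {w \<in> V. E v w})" using that by auto
    then have "card V = card (insert v ({w \<in> V. w \<noteq> v \<and> \<not> E v w} \<union> {w \<in> V. E v w}))"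
      by (rule arg_cong)
    also have "\<dots> \<le> Suc (card ({w \<in> V. w \<noteq> v \<and> \<not> E v w} \<union> {w \<in> V. E v w}))"
      using \<open>finite V\<close> by (simp add: card_insert_if)
    also have "\<dots> \<le> Suc (card {w \<in> V. w \<noteq> v \<and> \<not> E v w} + card {w \<in> V. E v w})"
      by (simp add: card_Un_le)
    finally show ?thesis using True[rule_format, OF that] card_V \<open>8 \<le> n\<close> by linarith
  qed
  moreover have "card V \<le> 2 * (n - 4) + 1" using card_V \<open>8 \<le> n\<close> by linarith
  ultimately have "\<exists>ps. distinct ps \<and> set ps = V \<and> successively E ps"
    using \<open>finite V\<close> sym irr by (intro Hamiltonian_path_min_degree) auto
  then obtain ps where "distinct ps" "set ps = V" "successively E ps" by blast
  moreover from this have "length ps = 2 * n - 7" using card_V distinct_card by metis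
  ultimately show ?thesis using m \<open>8 \<le> n\<close> by (intro exI[of _ ps]) auto
next
  case False
  then obtain v where v: "v \<in> V" "n - 4 < card {w \<in> V. w \<noteq> v \<and> \<not> E v w}" by force
  define A where "A = {w \<in> V. w \<noteq> v \<and> \<not> E v w}"
  define B where "B = {w \<in> V. E v w}"
  define d where "d = card A"
  have d: "n - 3 \<le> d" using v \<open>8 \<le> n\<close> by (simp add: A_def d_def)
  have sub: "A \<subseteq> V" "B \<subseteq> V" "v \<notin> A" "v \<notin> B" "A \<inter> B = {}"
    using irr v by (auto simp: A_def B_def)
  have fin: "finite A" "finite B" using sub \<open>finite V\<close> finite_subset by blast+
  have "V = insert v (A \<union> B)" using v by (auto simp: A_def B_def)
  then have card_B: "d + card B + 1 = 2 * n - 7"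
    using card_V fin sub by (simp add: card_Un_disjoint d_def)
  have not_A: "x \<notin> A" if "x \<in> B" for x using that sub by blast
  have A_ne: "A \<noteq> {}" using d \<open>8 \<le> n\<close> by (auto simp: d_def)
  \<comment> \<open>The source of all later exclusions of non-edges: in the complement
    \<open>v\<close> is joined to all of \<open>A\<close>, so such \<open>p\<close>,
    \<open>q\<close>, \<open>x\<close>, \<open>y\<close> complete a tree.\<close>
  have no: False
    if "p \<in> A" "q \<in> A" "p \<noteq> q" "x \<in> A \<union> B" "y \<in> A \<union> B" "x \<noteq> y" "x \<notin> {p, q}" "y \<notin> {p, q}"
      "\<not> E (if i = 1 then p else q) x" "\<not> E q y" "n - 3 \<le> card (A - {x, y})" for p q x y
  proof -
    define F where "F = (\<lambda>u w. u \<noteq> w \<and> \<not> E u w)"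
    have "contains (V, F) (tree_T i n)"
    proof (rule contains_tree_TI)
      show "F u w \<Longrightarrow> F w u" if "u \<in> V" "w \<in> V" for u w
        using that sym by (auto simp: F_def)
      show "F v u" if "u \<in> A" for u using that by (auto simp: A_def F_def)
      show "F (if i = 1 then p else q) x" using that(7,9) by (auto simp: F_def)
      show "F q y" using that(8,10) by (auto simp: F_def)
      show "n - 3 \<le> card (A - {x, y})" by fact
      show "p \<in> A" "q \<in> A" "p \<noteq> q" "x \<noteq> y" "finite V" "A \<subseteq> V" "v \<in> V" "v \<notin> A" by (fact that sub v \<open>finite V\<close>)+
      show "x \<in> V" "y \<in> V" "x \<notin> {v, p, q}" "y \<notin> {v, p, q}" using that sub by auto
      show "5 \<le> n" using \<open>8 \<le> n\<close> by simp
    qed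
    then show False using no_tree by (simp add: complement_def F_def)
  qed
  have other: "\<exists>p\<in>A. p \<notin> S" if "card S \<le> 3" "finite S" for S
  proof -
    have "card S < card A" using that d \<open>8 \<le> n\<close> by (simp add: d_def)
    then show ?thesis using that(2) by (meson card_mono leD subsetI)
  qed
  \<comment> \<open>For \<open>i \<noteq> 1\<close> both outer leaves hang on \<open>q\<close>, and
    \<open>p\<close> can be any vertex of \<open>A\<close> outside \<open>{q, x, y}\<close>.\<close>
  have no_cherry: False
    if "i \<noteq> 1" "q \<in> A" "x \<in> A \<union> B" "y \<in> A \<union> B" "x \<noteq> y" "x \<noteq> q" "y \<noteq> q"
      "\<not> E q x" "\<not> E q y" "n - 3 \<le> card (A - {x, y})" for q x y
  proof -
    have "card {q, x, y} \<le> 3" using that(5-7) by auto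
    then obtain p where "p \<in> A" "p \<notin> {q, x, y}" using other by blast
    then show False using no[of p q x y] that by auto
  qed
  have card_AB: "card (A - {x, y}) = d" if "x \<in> B" "y \<in> B" for x y
  proof -
    have "A - {x, y} = A" using that sub by auto
    then show ?thesis by (simp add: d_def)
  qed
  \<comment> \<open>Outer leaves in \<open>B\<close> cost no vertex of \<open>A\<close>, so
    \<open>n - 3 \<le> d\<close> suffices. For \<open>i = 1\<close> the non-edges between
    \<open>A\<close> and \<open>B\<close> contain no matching of size two; otherwise no vertex of
    \<open>A\<close> misses two vertices of \<open>B\<close>, and \<open>c\<close> is
    arbitrary.\<close>
  have "\<exists>c\<in>A. \<forall>z\<in>A - {c}. card {y \<in> B. \<not> E z y} \<le> 1"
  proof (cases "i = 1")
    case True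
    show ?thesis
    proof (rule no_matching_star[OF A_ne fin(2)])
      fix p q x y assume "p \<in> A" "q \<in> A" "p \<noteq> q" "x \<in> B" "y \<in> B" "x \<noteq> y" "\<not> E p x" "\<not> E q y"
      then show False by (intro no[of p q x y]) (use True d card_AB not_A in auto)
    qed
  next
    case False
    have "card {y \<in> B. \<not> E z y} \<le> 1" if "z \<in> A" for z
    proof -
      have "x = y" if "x \<in> B" "y \<in> B" "\<not> E z x" "\<not> E z y" for x y
        by (rule ccontr, rule no_cherry[of z x y]) (use False that \<open>z \<in> A\<close> d card_AB not_A in auto)
      then show ?thesis using fin(2) by (auto simp: card_le_Suc0_iff_eq)
    qed
    then show ?thesis using A_ne by blast
  qed
  then obtain c where c: "c \<in> A" "\<And>z. z \<in> A - {c} \<Longrightarrow> card {y \<in> B. \<not> E z y} \<le> 1" by blast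
  show ?thesis
  proof (cases "m \<le> 2 * card B")
    case True
    have X: "card (A - {c}) = d - 1" using c(1) fin by (simp add: d_def)
    obtain a where a: "a \<in> A - {c}" using other[of "{c}"] by auto
    have "\<exists>ps. distinct ps \<and> set ps \<subseteq> insert v ((A - {c}) \<union> B) \<and> length ps = 2 * card B \<and>
      successively E ps \<and> ps \<noteq> [] \<and> hd ps = a"
    proof (rule zigzag_path)
      show "2 \<le> card B" using True m \<open>8 \<le> n\<close> by linarith
      show "card B \<le> card (A - {c}) + 1" using X card_B d by linarith
      show "E v y \<and> E y v" if "y \<in> B" for y using that sym[of v y] v by (simp add: B_def)
      show "E y x" if "x \<in> A - {c}" "y \<in> B" "E x y" for x y using that sym sub by blast
    qed (use a c fin sub in auto)
    moreover have "insert v ((A - {c}) \<union> B) \<subseteq> V" using v sub by auto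
    ultimately show ?thesis using True by fastforce
  next
    case short: False
    show ?thesis
    \<comment> \<open>\<open>d = n - 3\<close> cannot occur here, since then
      \<open>2 * card B = 2 * n - 10\<close> is at least \<open>m\<close>. For
      \<open>d = n - 2\<close> only one outer leaf may be taken from \<open>A\<close>, for larger
      \<open>d\<close> both.\<close>
    proof (cases "d = n - 2")
      case True
      then have n: "n = 8" "m = 5" "d = 6" "card B = 2"
        using short card_B m \<open>8 \<le> n\<close> by linarith+
      obtain b b' where b: "B = {b, b'}" "b \<noteq> b'" using n(4) by (meson card_2_iff)
      \<comment> \<open>Two vertices outside \<open>D\<close> are adjacent to both \<open>b\<close>
        and \<open>b'\<close> and give a path on \<open>m = 5\<close> vertices through
        \<open>v\<close>. Otherwise \<open>D\<close> has at least five vertices, and a clique of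
        that size is found in \<open>A\<close>.\<close>
      define D where "D = {a \<in> A. \<exists>x\<in>B. \<not> E a x}"
      show ?thesis
      proof (cases "\<exists>a\<in>A - D. \<exists>a'\<in>A - D. a \<noteq> a'")
        case True
        then obtain a a' where a: "a \<in> A" "a' \<in> A" "a \<noteq> a'" "a \<notin> D" "a' \<notin> D" by blast
        have "E a b" "E a' b'" "E v b" "E v b'" using a b by (auto simp: D_def B_def)
        moreover have "{a, b, v, b', a'} \<subseteq> V" using a b v sub by auto
        ultimately have "successively E [a, b, v, b', a']" by (simp add: sym)
        then show ?thesis
          using a b sub v n by (intro exI[of _ "[a, b, v, b', a']"]) auto
      next
        case False
        then have "card (A - D) \<le> 1"
          using fin by (auto simp: card_le_Suc0_iff_eq)
        moreover have "D \<subseteq> A" by (auto simp: D_def)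
        ultimately have card_D: "5 \<le> card D"
          using n(3) fin(1) by (simp add: d_def card_Diff_subset finite_subset)
        have five: "card (A - {x, w}) = 5" if "x \<in> B" "w \<in> A" for x w
        proof -
          have "A - {x, w} = A - {w}" using that sub by auto
          then show ?thesis using that n(3) fin by (simp add: d_def)
        qed
        \<comment> \<open>One outer leaf is a missed \<open>x\<close> in \<open>B\<close>; a
          non-edge inside \<open>A\<close> would supply the other, at a vertex other than the one
          missing \<open>x\<close> if \<open>i = 1\<close>, at the same vertex otherwise. Hence
          \<open>A - {a}\<close>, respectively \<open>D\<close>, is a clique.\<close>
        have "\<exists>K\<subseteq>A. 5 \<le> card K \<and> (\<forall>u\<in>K. \<forall>w\<in>K. u \<noteq> w \<longrightarrow> E u w)"
        proof (cases "i = 1")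
          case True
          from card_D have "D \<noteq> {}" by auto
          then obtain a x where a: "a \<in> A" "x \<in> B" "\<not> E a x" by (auto simp: D_def)
          have "E u w" if "u \<in> A - {a}" "w \<in> A - {a}" "u \<noteq> w" for u w
            by (rule ccontr, rule no[of a u x w]) (use five[of x w] that a True not_A n in auto)
          moreover have "card (A - {a}) = 5" using a n(3) fin by (simp add: d_def)
          ultimately show ?thesis by (intro exI[of _ "A - {a}"]) auto
        next
          case False
          have "E u w" if u: "u \<in> D" and w: "w \<in> D" "u \<noteq> w" for u w
          proof -
            obtain x where "x \<in> B" "\<not> E u x" using u by (auto simp: D_def)
            then show ?thesis
              by (intro ccontr[of "E u w"], intro no_cherry[of u x w])
                (use five[of x w] u w False not_A n in \<open>auto simp: D_def\<close>)
          qed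
          then show ?thesis using card_D \<open>D \<subseteq> A\<close> by blast
        qed
        then obtain K where K: "K \<subseteq> A" "5 \<le> card K"
          "\<And>u w. u \<in> K \<Longrightarrow> w \<in> K \<Longrightarrow> u \<noteq> w \<Longrightarrow> E u w" by blast
        obtain ps where ps: "set ps = K" "distinct ps"
          using K fin by (meson finite_distinct_list finite_subset)
        then have "successively E ps" using K by (intro successively_clique) auto
        then show ?thesis using ps K sub n distinct_card[of ps] by (intro exI[of _ ps]) auto
      qed
    next
      case False
      then have large: "n - 1 \<le> d" "m + 1 \<le> d"
        using short card_B m d \<open>8 \<le> n\<close> by linarith+
      have card_A: "n - 3 \<le> card (A - {x, y})" for x y
      proof -
        have "card A - card {x, y} \<le> card (A - {x, y})" by (rule diff_card_le_card_Diff) simp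
        moreover have "card {x, y} \<le> 2" by (simp add: card_insert_if)
        ultimately show ?thesis using large by (simp add: d_def)
      qed
      define R where "R u w \<longleftrightarrow> u \<noteq> w \<and> \<not> E u w" for u w
      \<comment> \<open>Both outer leaves may now lie in \<open>A\<close>. For \<open>i = 1\<close>
        the complement on \<open>A\<close> has no two disjoint edges; otherwise its degrees are at
        most one, and any vertex can be deleted.\<close>
      have "\<exists>c\<in>A. \<forall>z\<in>A - {c}. card {y \<in> A - {c}. R z y} \<le> 1"
      proof (cases "i = 1")
        case True
        show ?thesis
        proof (rule no_two_disjoint_edges[OF A_ne fin(1)])
          show "R w u" if "u \<in> A" "w \<in> A" "R u w" for u w
            using that sym sub by (auto simp: R_def)
          show "\<not> R u u" for u by (simp add: R_def)
          show False if "p \<in> A" "q \<in> A" "x \<in> A" "y \<in> A" "p \<noteq> q" "x \<noteq> y" "x \<notin> {p, q}" "y \<notin> {p, q}"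
            "R p x" "R q y" for p q x y
            by (rule no[of p q x y]) (use card_A[of x y] that True in \<open>auto simp: R_def\<close>)
        qed
      next
        case False
        have "card {y \<in> A - {c}. R z y} \<le> 1" if "z \<in> A" for z
        proof -
          have "x = y" if "x \<in> A" "y \<in> A" "R z x" "R z y" for x y
            by (rule ccontr, rule no_cherry[of z x y])
              (use False that \<open>z \<in> A\<close> card_A[of x y] in \<open>auto simp: R_def\<close>)
          then show ?thesis using fin(1) by (auto simp: card_le_Suc0_iff_eq)
        qed
        then show ?thesis using c(1) by blast
      qed
      then obtain e where e: "e \<in> A" "\<And>z. z \<in> A - {e} \<Longrightarrow> card {y \<in> A - {e}. R z y} \<le> 1" by blast
      define K where "K = A - {e}"
      have K: "K \<subseteq> V" "finite K" "card K = d - 1" using e fin sub by (auto simp: K_def d_def)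
      \<comment> \<open>Each of the \<open>d - 1\<close> vertices of \<open>K\<close> misses at most
        one other, which leaves degree \<open>d - 3\<close>; a Hamiltonian path of \<open>K\<close>
        has \<open>d - 1 \<ge> m\<close> vertices.\<close>
      have deg: "d - 3 \<le> card {w \<in> K. E u w}" if "u \<in> K" for u
      proof -
        have "K = insert u ({w \<in> K. R u w} \<union> {w \<in> K. E u w})" using that by (auto simp: R_def)
        then have "card K = card (insert u ({w \<in> K. R u w} \<union> {w \<in> K. E u w}))"
          by (rule arg_cong)
        also have "\<dots> \<le> Suc (card ({w \<in> K. R u w} \<union> {w \<in> K. E u w}))"
          using K(2) by (simp add: card_insert_if)
        also have "\<dots> \<le> Suc (card {w \<in> K. R u w} + card {w \<in> K. E u w})"
          by (simp add: card_Un_le)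
        finally show ?thesis using e(2)[of u] that K(3) by (simp add: K_def)
      qed
      have "\<exists>ps. distinct ps \<and> set ps = K \<and> successively E ps"
      proof (rule Hamiltonian_path_min_degree[OF K(2) _ _ deg])
        show "card K \<le> 2 * (d - 3) + 1" using K(3) large \<open>8 \<le> n\<close> by linarith
        show "E u w \<Longrightarrow> E w u" if "u \<in> K" "w \<in> K" for u w using that K(1) sym by blast
      qed (use K(1) irr in auto)
      then obtain ps where "distinct ps" "set ps = K" "successively E ps" by blast
      then show ?thesis using K large distinct_card[of ps] by (intro exI[of _ ps]) auto
    qed
  qed
qed

section \<open>The lower bound\<close>

text \<open>Both cliques have at most \<open>n - 4\<close> vertices. A path stays inside one of
  them, and in the complement the \<open>n - 3\<close> neighbours of the tree's centre would have to
  fit into the opposite side. All \<open>N \<le> 2 * n - 8\<close> are covered because leastness of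
  \<open>2 * n - 7\<close> concerns every smaller \<open>N\<close>.\<close>

lemma two_cliques_no_path_no_tree:
  fixes N n m i :: nat
  defines "E \<equiv> \<lambda>u w. u \<noteq> w \<and> (u < n - 4 \<longleftrightarrow> w < n - 4)"
  assumes "8 \<le> n" "N \<le> 2 * n - 8" "n - 3 \<le> m"
  shows "simple_graph ({..<N}, E)" "\<not> contains ({..<N}, E) (path_graph m)"
    "\<not> contains (complement ({..<N}, E)) (tree_T i n)"
proof -
  define side where "side s = {w \<in> {..<N}. w < n - 4 \<longleftrightarrow> s}" for s
  have side_card: "card (side s) \<le> n - 4" for s
  proof (cases s)
    case True
    then have "side s \<subseteq> {..<n - 4}" by (auto simp: side_def)
    then show ?thesis by (metis card_lessThan card_mono finite_lessThan)
  next
    case False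
    then have "side s \<subseteq> {n - 4..<N}" by (auto simp: side_def)
    then have "card (side s) \<le> N - (n - 4)" by (metis card_atLeastLessThan card_mono finite_atLeastLessThan)
    then show ?thesis using assms by linarith
  qed
  have fin: "finite (side s)" for s by (simp add: side_def)
  show "simple_graph ({..<N}, E)" by (auto simp: simple_graph_def E_def)
  show "\<not> contains ({..<N}, E) (path_graph m)"
  proof
    assume "contains ({..<N}, E) (path_graph m)"
    then obtain f where f: "inj_on f {..<m}" "f ` {..<m} \<subseteq> {..<N}"
      "\<And>k. Suc k < m \<Longrightarrow> E (f k) (f (Suc k))"
      by (auto simp: contains_def path_graph_def)
    have "f k < n - 4 \<longleftrightarrow> f 0 < n - 4" if "k < m" for k
      using that
    proof (induction k)
      case (Suc k)
      then show ?case using f(3)[of k] by (auto simp: E_def)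
    qed simp
    then have "f ` {..<m} \<subseteq> side (f 0 < n - 4)" using f(2) by (auto simp: side_def)
    then have "card (f ` {..<m}) \<le> n - 4" using fin side_card by (meson card_mono le_trans)
    then show False using assms f(1) by (simp add: card_image)
  qed
  show "\<not> contains (complement ({..<N}, E)) (tree_T i n)"
  proof
    assume "contains (complement ({..<N}, E)) (tree_T i n)"
    then obtain f where f: "inj_on f {..<n}" "f ` {..<n} \<subseteq> {..<N}"
      "\<And>u w. u < n \<Longrightarrow> w < n \<Longrightarrow> snd (tree_T i n) u w \<Longrightarrow> f u \<noteq> f w \<and> \<not> E (f u) (f w)"
      by (auto simp: contains_def complement_def tree_T_def)
    have "f k \<in> side (\<not> f 0 < n - 4)" if "k \<in> {1..n - 3}" for k
    proof -
      have "f 0 \<noteq> f k \<and> \<not> E (f 0) (f k)"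
        using that \<open>8 \<le> n\<close> by (intro f(3)) (auto simp: tree_T_def T1_rel_def T2_rel_def)
      moreover have "k < n" using that \<open>8 \<le> n\<close> by auto
      then have "f k < N" using f(2) by blast
      ultimately show ?thesis by (auto simp: E_def side_def)
    qed
    then have "card (f ` {1..n - 3}) \<le> n - 4"
      using fin side_card by (meson card_mono image_subsetI le_trans)
    moreover have "inj_on f {1..n - 3}" using f(1) by (rule inj_on_subset) (use \<open>8 \<le> n\<close> in auto)
    ultimately show False using \<open>8 \<le> n\<close> by (simp add: card_image)
  qed
qed

section \<open>The Ramsey numbers\<close>

lemma ramsey_path_tree_T:
  assumes "8 \<le> n"
    and m: "m + 3 = n \<or> m + 2 = n \<and> 11 \<le> n \<or> m + 1 = n \<and> 13 \<le> n \<or> m = n \<and> 17 \<le> n"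
  shows "ramsey (path_graph m) (tree_T i n) = 2 * n - 7"
  unfolding ramsey_def
proof (rule Least_equality, intro conjI allI impI)
  show "0 < 2 * n - 7" using assms by simp
  fix E :: "nat \<Rightarrow> nat \<Rightarrow> bool"
  assume simple: "simple_graph ({..<2 * n - 7}, E)"
  then have sym: "E w u" if "u \<in> {..<2 * n - 7}" "w \<in> {..<2 * n - 7}" "E u w" for u w
    using that by (simp add: simple_graph_def)
  have irr: "\<not> E u u" if "u \<in> {..<2 * n - 7}" for u
    using that simple by (simp add: simple_graph_def)
  show "contains ({..<2 * n - 7}, E) (path_graph m) \<or>
    contains (complement ({..<2 * n - 7}, E)) (tree_T i n)"
  proof (rule disjCI)
    assume "\<not> contains (complement ({..<2 * n - 7}, E)) (tree_T i n)"
    then have "\<exists>ps. distinct ps \<and> set ps \<subseteq> {..<2 * n - 7} \<and> successively E ps \<and> m \<le> length ps"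
      using assms sym irr by (intro path_or_tree_in_complement) auto
    then show "contains ({..<2 * n - 7}, E) (path_graph m)"
      using contains_path_graphI sym by metis
  qed
next
  fix N
  assume N: "0 < N \<and> (\<forall>E :: nat \<Rightarrow> nat \<Rightarrow> bool. simple_graph ({..<N}, E) \<longrightarrow>
    contains ({..<N}, E) (path_graph m) \<or> contains (complement ({..<N}, E)) (tree_T i n))"
  have "n - 3 \<le> m" using m by linarith
  then have "\<not> N \<le> 2 * n - 8" using two_cliques_no_path_no_tree[OF assms(1)] N by blast
  then show "2 * n - 7 \<le> N" by linarith
qed

theorem theorem4p3:
  fixes n i :: nat
  assumes "i \<in> {1, 2}"
  shows "(n \<ge> 17 \<longrightarrow> ramsey (path_graph n) (tree_T i n) = 2 * n - 7) \<and>
         (n \<ge> 13 \<longrightarrow> ramsey (path_graph (n - 1)) (tree_T i n) = 2 * n - 7) \<and>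
         (n \<ge> 11 \<longrightarrow> ramsey (path_graph (n - 2)) (tree_T i n) = 2 * n - 7) \<and>
         (n \<ge> 8 \<longrightarrow> ramsey (path_graph (n - 3)) (tree_T i n) = 2 * n - 7)"
  by (intro conjI impI; rule ramsey_path_tree_T; linarith)

end
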